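(* As $N\to\infty$, $$\frac1N\sum_{n=1}^{N}\log\frac{s(2n)}{2n}=\lambda+O\!\left(\frac{1}{\log N}\right),$$ where $$\lambda=\alpha(2)+\sum_{p\ \mathrm{prime}}\alpha(p)-\sum_{j\geq1}\frac1j\left((2\beta_j(2)-1)\prod_{p\geq3\ \mathrm{prime}}\beta_j(p)\right),$$ with, for a prime $p$ and an integer $j\geq1$, $$\alpha(p)=\left(1-\frac1p\right)\sum_{m\geq1}\frac{1}{p^m}\log\left(1+\frac1p+\cdots+\frac1{p^m}\right),\qquad \beta_j(p)=\left(1-\frac1p\right)\sum_{m\geq0}\frac{1}{p^m}\left(1+\frac1p+\cdots+\frac1{p^m}\right)^{-j}.$$
   Context: For an integer $n>1$, $s(n)=\sum_{d\mid n,\ d<n}d=\sigma(n)-n$, where $\sigma(n)=\sum_{d\mid n}d$. *)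

theory Defs
  imports "HOL-Analysis.Analysis" "HOL-Library.Landau_Symbols" "HOL-Computational_Algebra.Primes"
begin

definition aliquot :: "nat \<Rightarrow> nat" where
  "aliquot n = (\<Sum>d \<in> {d. d dvd n \<and> d < n}. d)"

definition hsum :: "nat \<Rightarrow> nat \<Rightarrow> real" where
  "hsum p m = (\<Sum>i=0..m. 1 / real p ^ i)"

definition alpha :: "nat \<Rightarrow> real" where
  "alpha p = (1 - 1 / real p) * (\<Sum>m. 1 / real p ^ Suc m * ln (hsum p (Suc m)))"

definition beta :: "nat \<Rightarrow> nat \<Rightarrow> real" where
  "beta j p = (1 - 1 / real p) * (\<Sum>m. 1 / real p ^ m * (1 / hsum p m ^ j))"

definition lambda_const :: real where
  "lambda_const =
     alpha 2 + (\<Sum>\<^sub>\<infinity>p\<in>{p::nat. prime p}. alpha p)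
     - (\<Sum>j. 1 / real (Suc j) *
          ((2 * beta (Suc j) 2 - 1) *
           (\<Prod>p. if prime p \<and> p \<ge> 3 then beta (Suc j) p else 1)))"

end

theory Submission
  imports Defs
begin

text \<open>
  With \<open>h(n) = \<sigma>(n) / n\<close> we have
  \<open>log (s(2n) / 2n) = log (h(2n) - 1) = log h(2n) - \<Sum>\<^sub>j h(2n)\<^sup>-\<^sup>j / j\<close>.
  The means of the additive function \<open>log h(2n)\<close> and of the multiplicative functions \<open>h(2n)\<^sup>-\<^sup>j\<close>
  are computed one prime at a time. If \<open>F\<close> ignores the prime \<open>p\<close> and
  \<open>\<Sum>\<^bsub>n \<le> x\<^esub> F(n) = M x + O(C \<surd>x)\<close> for all real \<open>x \<ge> 0\<close>, then writing a function \<open>f\<close> of the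
  multiplicity \<open>v(n)\<close> of \<open>p\<close> in \<open>n\<close> as \<open>f(0) + \<Sum>\<^bsub>m \<ge> 1, p^m | n\<^esub> (f(m) - f(m - 1))\<close> gives the same kind
  of estimate for \<open>f(v(n)) F(n)\<close>, where \<open>M\<close> and \<open>C\<close> are multiplied by local factors. The product
  of the factors of \<open>C\<close> over all primes is at most \<open>K\<^sup>j\<close>, so the mean of \<open>h(2n)\<^sup>-\<^sup>j\<close> over \<open>n \<le> N\<close>
  has error at most \<open>K\<^sup>j / \<surd>N\<close>. Since \<open>h(2n) \<ge> 3/2\<close>, this error is also at most \<open>(2/3)\<^sup>j\<close>;
  interpolating between the two bounds makes the sum over \<open>j\<close> converge with a power saving in \<open>N\<close>.
\<close>

subsection \<open>Mean values one prime at a time\<close>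

definition summatory :: "(nat \<Rightarrow> real) \<Rightarrow> real \<Rightarrow> real" where
  "summatory F x = (\<Sum>n | 0 < n \<and> real n \<le> x. F n)"

text \<open>The variable ranges over all reals x \<ge> 0, so the estimate can be rescaled to x /
  p^m, even below 1. With exponent 1/2, rescaling by p gains 1 / sqrt p, and the resulting sum of 1
  / (p sqrt p) over primes converges.\<close>

definition has_mean :: "(nat \<Rightarrow> real) \<Rightarrow> real \<Rightarrow> real \<Rightarrow> bool" where
  "has_mean F M C \<longleftrightarrow> (\<forall>x\<ge>0. \<bar>summatory F x - x * M\<bar> \<le> C * sqrt x)"

text \<open>Expectation of \<open>f\<close> of the multiplicity of \<open>p\<close>: the integers
  with multiplicity exactly m have density (1 - 1/p) / p^m.\<close>

definition pmean :: "nat \<Rightarrow> (nat \<Rightarrow> real) \<Rightarrow> real" where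
  "pmean p f = (1 - 1 / real p) * (\<Sum>m. 1 / real p ^ m * f m)"

lemma finite_nat_le_real: "finite {n. 0 < n \<and> real n \<le> x}"
proof (rule finite_subset)
  show "{n. 0 < n \<and> real n \<le> x} \<subseteq> {..nat \<lfloor>x\<rfloor>}"
    by (auto simp: le_nat_floor)
qed simp

lemma summatory_of_nat: "summatory F (real N) = (\<Sum>n=1..N. F n)"
  unfolding summatory_def by (rule sum.cong) auto

lemma summatory_multiples:
  assumes "q > 0"
  shows "(\<Sum>n | 0 < n \<and> real n \<le> x \<and> q dvd n. F n) = summatory (\<lambda>k. F (q * k)) (x / real q)"
  unfolding summatory_def
proof (rule sum.reindex_bij_witness[of _ "\<lambda>k. q * k" "\<lambda>n. n div q"], goal_cases)
  case (2 n)
  then show ?case using assms by (auto elim!: dvdE simp: field_simps)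
qed (use assms in \<open>auto simp: field_simps\<close>)

text \<open>Telescoping writes \<open>f\<close> at the multiplicity as \<open>f 0\<close> plus the
  increments over all m with p^(m+1) dividing n. The multiples of p^(m+1) up to x then contribute
  \<open>F\<close> summed up to x / p^(m+1), because \<open>F\<close> is unaffected by factors p.
  The bound L \<ge> x guarantees that all multiplicities are at most L.\<close>

lemma summatory_prime_twist:
  assumes p: "prime p" and F: "\<And>n. n > 0 \<Longrightarrow> F (p * n) = F n" and L: "x \<le> real L"
  shows "summatory (\<lambda>n. f (multiplicity p n) * F n) x =
    f 0 * summatory F x + (\<Sum>m<L. (f (Suc m) - f m) * summatory F (x / real p ^ Suc m))"
proof -
  let ?A = "{n. 0 < n \<and> real n \<le> x}"
  have Fpow: "F (p ^ m * n) = F n" if "n > 0" for m n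
    using that F p by (induction m) (auto simp: mult.assoc prime_gt_0_nat)
  have f_eq: "f (multiplicity p n) = f 0 + (\<Sum>m<L. (f (Suc m) - f m) * of_bool (p ^ Suc m dvd n))"
    if n: "n \<in> ?A" for n
  proof -
    have "n < p ^ n"
      using p by (intro power_gt_expt) (auto simp: prime_nat_iff)
    then have "\<not> p ^ n dvd n"
      using n by (auto dest: dvd_imp_le)
    then have "multiplicity p n < n"
      using n p by (intro multiplicity_lessI) (auto simp: prime_nat_iff)
    then have le: "multiplicity p n \<le> L"
      using n L by simp
    have iff: "p ^ Suc m dvd n \<longleftrightarrow> m < multiplicity p n" for m
    proof -
      have "p ^ Suc m dvd n \<longleftrightarrow> Suc m \<le> multiplicity p n"
        by (rule power_dvd_iff_le_multiplicity) (use n p in \<open>auto simp: prime_nat_iff\<close>)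
      then show ?thesis by auto
    qed
    have "(\<Sum>m<L. (f (Suc m) - f m) * of_bool (p ^ Suc m dvd n)) =
          (\<Sum>m<multiplicity p n. f (Suc m) - f m)"
      unfolding iff using le by (intro sum.mono_neutral_cong_right) auto
    then show ?thesis
      by (simp add: sum_lessThan_telescope)
  qed
  have "summatory (\<lambda>n. f (multiplicity p n) * F n) x =
    (\<Sum>n\<in>?A. f 0 * F n + (\<Sum>m<L. (f (Suc m) - f m) * (of_bool (p ^ Suc m dvd n) * F n)))"
    unfolding summatory_def
    by (rule sum.cong) (simp_all only: f_eq distrib_right sum_distrib_right mult.assoc)
  also have "\<dots> = f 0 * summatory F x +
      (\<Sum>m<L. (f (Suc m) - f m) * (\<Sum>n\<in>?A. of_bool (p ^ Suc m dvd n) * F n))"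
    unfolding summatory_def sum.distrib sum_distrib_left
    by (intro arg_cong2[of _ _ _ _ "(+)"] refl sum.swap)
  also have "(\<lambda>m. \<Sum>n\<in>?A. of_bool (p ^ Suc m dvd n) * F n) =
             (\<lambda>m. summatory F (x / real p ^ Suc m))"
  proof
    fix m
    have "(\<Sum>n\<in>?A. of_bool (p ^ Suc m dvd n) * F n) =
          (\<Sum>n | 0 < n \<and> real n \<le> x \<and> p ^ Suc m dvd n. F n)"
      by (rule sum.mono_neutral_cong_right) (auto intro: finite_nat_le_real)
    also have "\<dots> = summatory (\<lambda>k. F (p ^ Suc m * k)) (x / real (p ^ Suc m))"
      by (rule summatory_multiples) (use p in \<open>auto simp: prime_gt_0_nat\<close>)
    also have "\<dots> = summatory F (x / real p ^ Suc m)"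
      unfolding summatory_def using Fpow[of _ "Suc m"] by (intro sum.cong) auto
    finally show "(\<Sum>n\<in>?A. of_bool (p ^ Suc m dvd n) * F n) = summatory F (x / real p ^ Suc m)" .
  qed
  finally show ?thesis .
qed

lemma sum_power_Suc_le:
  fixes r :: real
  assumes "0 \<le> r" "r \<le> 1 / 2"
  shows "(\<Sum>m<L. r ^ Suc m) \<le> 2 * r"
proof -
  have "(\<Sum>m<L. r ^ m) = (1 - r ^ L) / (1 - r)"
    using assms by (simp add: sum_gp_strict)
  also have "\<dots> \<le> 2"
  proof -
    have "1 - r ^ L \<le> 1"
      using assms by simp
    also have "1 \<le> 2 * (1 - r)"
      using assms by simp
    finally show ?thesis
      using assms by (simp add: divide_le_eq)
  qed
  finally have "r * (\<Sum>m<L. r ^ m) \<le> r * 2"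
    using assms by (intro mult_left_mono)
  then show ?thesis
    by (simp add: sum_distrib_left mult.commute)
qed

text \<open>Abel summation turns the truncated sum of increments, the form produced by the twist,
  into the density-weighted sum plus a boundary term, which is the general term of a convergent
  series.\<close>

lemma pmean_LIMSEQ:
  assumes p: "prime p" and bounded: "\<And>m. \<bar>f m\<bar> \<le> b"
  shows "(\<lambda>L. f 0 + (\<Sum>m<L. (f (Suc m) - f m) / real p ^ Suc m)) \<longlonglongrightarrow> pmean p f"
proof -
  have p2: "real p \<ge> 2"
    using prime_ge_2_nat[OF p] by simp
  have Abel: "f 0 + (\<Sum>m<L. (f (Suc m) - f m) / real p ^ Suc m) =
    (1 - 1 / real p) * (\<Sum>m<L. 1 / real p ^ m * f m) + f L / real p ^ L" for L
    using p2 by (induction L) (simp_all add: field_simps)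
  have geo: "summable (\<lambda>m. b * (1 / real p) ^ m)"
    using p2 by (intro summable_mult summable_geometric) auto
  have le: "norm (1 / real p ^ m * f m) \<le> b * (1 / real p) ^ m" for m
    using bounded[of m] p2 by (simp add: abs_mult field_simps)
  have summ: "summable (\<lambda>m. 1 / real p ^ m * f m)"
    by (rule summable_comparison_test'[OF geo]) (rule le)
  have "(\<lambda>L. (1 - 1 / real p) * (\<Sum>m<L. 1 / real p ^ m * f m) + f L / real p ^ L)
          \<longlonglongrightarrow> (1 - 1 / real p) * (\<Sum>m. 1 / real p ^ m * f m) + 0"
    using summable_LIMSEQ_zero[OF summ]
    by (intro tendsto_intros summable_LIMSEQ summ) simp
  then show ?thesis
    unfolding Abel pmean_def by simp
qed

text \<open>Each increment carries one factor 1 / p^(m+1) by hypothesis and a second from the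
  density of the multiples of p^(m+1). The resulting O(1/p^2) makes sums and products of local means
  over all primes converge.\<close>

lemma pmean_diff_bound:
  assumes p: "prime p" and bounded: "\<And>m. \<bar>f m\<bar> \<le> b"
    and incr: "\<And>m. \<bar>f (Suc m) - f m\<bar> \<le> c / real p ^ Suc m"
  shows "\<bar>pmean p f - f 0\<bar> \<le> 2 * c / (real p)\<^sup>2"
proof -
  have p2: "real p \<ge> 2"
    using prime_ge_2_nat[OF p] by simp
  have c: "0 \<le> c"
    using order_trans[OF abs_ge_zero incr[of 0]] p2 by (simp add: field_simps)
  have r: "1 / (real p)\<^sup>2 \<le> 1 / 2"
    using mult_mono[OF p2 p2] p2 by (simp add: power2_eq_square field_simps)
  have "\<bar>(f 0 + (\<Sum>m<L. (f (Suc m) - f m) / real p ^ Suc m)) - f 0\<bar> \<le> 2 * c / (real p)\<^sup>2" for L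
  proof -
    have "\<bar>\<Sum>m<L. (f (Suc m) - f m) / real p ^ Suc m\<bar> \<le> (\<Sum>m<L. c * (1 / (real p)\<^sup>2) ^ Suc m)"
    proof (rule order_trans[OF sum_abs sum_mono])
      fix m
      have "\<bar>(f (Suc m) - f m) / real p ^ Suc m\<bar> \<le> (c / real p ^ Suc m) / real p ^ Suc m"
        unfolding abs_divide using p2 incr[of m] by (intro frac_le) auto
      also have "\<dots> = c * (1 / (real p)\<^sup>2) ^ Suc m"
        by (simp add: power_mult_distrib power2_eq_square field_simps)
      finally show "\<bar>(f (Suc m) - f m) / real p ^ Suc m\<bar> \<le> c * (1 / (real p)\<^sup>2) ^ Suc m" .
    qed
    also have "\<dots> \<le> c * (2 * (1 / (real p)\<^sup>2))"
      unfolding sum_distrib_left[symmetric] by (intro mult_left_mono sum_power_Suc_le c r) auto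
    finally show ?thesis by (simp add: mult.commute)
  qed
  moreover have "(\<lambda>L. \<bar>(f 0 + (\<Sum>m<L. (f (Suc m) - f m) / real p ^ Suc m)) - f 0\<bar>)
                   \<longlonglongrightarrow> \<bar>pmean p f - f 0\<bar>"
    by (intro tendsto_intros pmean_LIMSEQ[OF p bounded])
  ultimately show ?thesis
    by (intro LIMSEQ_le_const2) auto
qed

text \<open>Since the hypothesis on \<^term>\<open>F\<close> is uniform in \<^term>\<open>x\<close>, it applies at every scale
  \<open>x / p ^ m\<close>, and the error constant just gets multiplied by a local factor.\<close>

lemma has_mean_prime_twist:
  assumes p: "prime p" and F: "\<And>n. n > 0 \<Longrightarrow> F (p * n) = F n"
    and mean: "has_mean F M C" and C: "C \<ge> 0"
    and bounded: "\<And>m. \<bar>f m\<bar> \<le> b"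
    and incr: "\<And>m. \<bar>f (Suc m) - f m\<bar> \<le> c / real p ^ Suc m"
  shows "has_mean (\<lambda>n. f (multiplicity p n) * F n) (pmean p f * M)
           ((\<bar>f 0\<bar> + 2 * c / (real p * sqrt (real p))) * C)"
  unfolding has_mean_def
proof (intro allI impI)
  fix x :: real
  assume x: "x \<ge> 0"
  have p2: "real p \<ge> 2"
    using prime_ge_2_nat[OF p] by simp
  have c: "0 \<le> c"
    using order_trans[OF abs_ge_zero incr[of 0]] p2 by (simp add: field_simps)
  \<comment> \<open>Ratio of the geometric error series: 1/p from the increment bound and 1 / sqrt p
    from the square-root error at scale x / p.\<close>
  let ?r = "1 / (real p * sqrt (real p))"
  have r: "?r \<le> 1 / 2"
  proof -
    have "real p * sqrt (real p) \<ge> 2 * 1"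
      using p2 by (intro mult_mono) auto
    then show ?thesis
      using p2 by (simp add: field_simps)
  qed
  let ?S = "summatory F" and ?T = "summatory (\<lambda>n. f (multiplicity p n) * F n) x"
  let ?E = "(\<bar>f 0\<bar> + 2 * c / (real p * sqrt (real p))) * C * sqrt x"
  have bound: "\<bar>?T - x * ((f 0 + (\<Sum>m<L. (f (Suc m) - f m) / real p ^ Suc m)) * M)\<bar> \<le> ?E"
    if L: "x \<le> real L" for L
  proof -
    let ?R = "\<lambda>t. ?S t - t * M"
    have R: "\<bar>?R t\<bar> \<le> C * sqrt t" if "t \<ge> 0" for t
      using mean that unfolding has_mean_def by auto
    \<comment> \<open>With every sum of \<open>F\<close> split into mean plus remainder, the means
      add up to x times the truncated local mean times \<open>M\<close>, and only remainders are
      left.\<close>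
    have "?T - x * ((f 0 + (\<Sum>m<L. (f (Suc m) - f m) / real p ^ Suc m)) * M) =
          f 0 * ?R x + (\<Sum>m<L. (f (Suc m) - f m) * ?R (x / real p ^ Suc m))"
    proof -
      have "?T = f 0 * ?S x + (\<Sum>m<L. (f (Suc m) - f m) * ?S (x / real p ^ Suc m))"
        using p F L by (intro summatory_prime_twist)
      moreover have "(\<Sum>m<L. (f (Suc m) - f m) * ?R (x / real p ^ Suc m)) =
          (\<Sum>m<L. (f (Suc m) - f m) * ?S (x / real p ^ Suc m)) -
          x * ((\<Sum>m<L. (f (Suc m) - f m) / real p ^ Suc m) * M)"
        unfolding sum_distrib_left sum_distrib_right sum_subtractf[symmetric]
        by (intro sum.cong) (simp_all add: field_simps)
      ultimately show ?thesis
        by (simp only:) (simp add: algebra_simps)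
    qed
    also have "\<bar>\<dots>\<bar> \<le> \<bar>f 0\<bar> * (C * sqrt x) + (\<Sum>m<L. (c * C * sqrt x) * ?r ^ Suc m)"
    proof (rule order_trans[OF abs_triangle_ineq], rule add_mono)
      show "\<bar>f 0 * ?R x\<bar> \<le> \<bar>f 0\<bar> * (C * sqrt x)"
        unfolding abs_mult using R[OF x] by (intro mult_left_mono) auto
      show "\<bar>\<Sum>m<L. (f (Suc m) - f m) * ?R (x / real p ^ Suc m)\<bar>
              \<le> (\<Sum>m<L. (c * C * sqrt x) * ?r ^ Suc m)"
      proof (rule order_trans[OF sum_abs sum_mono])
        fix m
        have "\<bar>(f (Suc m) - f m) * ?R (x / real p ^ Suc m)\<bar>
                \<le> (c / real p ^ Suc m) * (C * sqrt (x / real p ^ Suc m))"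
          unfolding abs_mult using incr[of m] c p2 x C by (intro mult_mono R) auto
        also have "\<dots> = (c * C * sqrt x) * ?r ^ Suc m"
          by (simp add: real_sqrt_divide real_sqrt_mult real_sqrt_power power_mult_distrib field_simps)
        finally show "\<bar>(f (Suc m) - f m) * ?R (x / real p ^ Suc m)\<bar> \<le> (c * C * sqrt x) * ?r ^ Suc m" .
      qed
    qed
    also have "\<dots> \<le> \<bar>f 0\<bar> * (C * sqrt x) + (c * C * sqrt x) * (2 * ?r)"
      unfolding sum_distrib_left[symmetric] using c C x r p2
      by (intro add_mono mult_left_mono sum_power_Suc_le) auto
    also have "\<dots> = ?E"
      by (simp add: algebra_simps)
    finally show ?thesis .
  qed
  \<comment> \<open>The bound \<open>?E\<close> is independent of L, so it survives the passage from
    the truncated local mean to \<open>pmean p f\<close>.\<close>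
  have "(\<lambda>L. \<bar>?T - x * ((f 0 + (\<Sum>m<L. (f (Suc m) - f m) / real p ^ Suc m)) * M)\<bar>)
          \<longlonglongrightarrow> \<bar>?T - x * (pmean p f * M)\<bar>"
    by (intro tendsto_intros pmean_LIMSEQ[OF p bounded])
  then show "\<bar>?T - x * (pmean p f * M)\<bar> \<le> ?E"
  proof (rule LIMSEQ_le_const2)
    have "\<bar>?T - x * ((f 0 + (\<Sum>m<L. (f (Suc m) - f m) / real p ^ Suc m)) * M)\<bar> \<le> ?E"
      if "L \<ge> nat \<lceil>x\<rceil>" for L
      using that by (intro bound) linarith
    then show "\<exists>L0. \<forall>L\<ge>L0. \<bar>?T - x * ((f 0 + (\<Sum>m<L. (f (Suc m) - f m) / real p ^ Suc m)) * M)\<bar> \<le> ?E"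
      by blast
  qed
qed

lemma has_mean_const_1: "has_mean (\<lambda>_. 1) 1 1"
  unfolding has_mean_def
proof (intro allI impI)
  fix x :: real
  assume x: "x \<ge> 0"
  have "{n. 0 < n \<and> real n \<le> x} = {1..nat \<lfloor>x\<rfloor>}"
    using x by (auto simp: le_nat_floor) (linarith)
  then have eq: "summatory (\<lambda>_. 1) x = of_int \<lfloor>x\<rfloor>"
    using x by (simp add: summatory_def)
  show "\<bar>summatory (\<lambda>_. 1) x - x * 1\<bar> \<le> 1 * sqrt x"
  \<comment> \<open>For x < 1 the sum is empty and the error x is at most sqrt x; for x \<ge> 1 the
    error of the floor is below 1, hence below sqrt x.\<close>
  proof (cases "x < 1")
    case True
    then have "\<lfloor>x\<rfloor> = 0" using x by linarith
    moreover have "x \<le> sqrt x"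
      using True x by (intro real_le_rsqrt) (simp add: power2_eq_square mult_left_le)
    ultimately show ?thesis using x by (simp add: eq)
  next
    case False
    then have "1 \<le> sqrt x" by simp
    then show ?thesis unfolding eq by linarith
  qed
qed

text \<open>Primes are inserted one at a time, starting from the constant 1: multiplying n by the
  new prime leaves the multiplicities of the others alone, so the product built so far can serve as
  \<open>F\<close> in the one-prime twist.\<close>

lemma has_mean_prod:
  assumes "finite P" and "\<And>p. p \<in> P \<Longrightarrow> prime p"
    and "\<And>p m. p \<in> P \<Longrightarrow> \<bar>f p m\<bar> \<le> b"
    and "\<And>p m. p \<in> P \<Longrightarrow> \<bar>f p (Suc m) - f p m\<bar> \<le> c / real p ^ Suc m"
    and c: "c \<ge> 0"
  shows "has_mean (\<lambda>n. \<Prod>p\<in>P. f p (multiplicity p n)) (\<Prod>p\<in>P. pmean p (f p))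
           (\<Prod>p\<in>P. \<bar>f p 0\<bar> + 2 * c / (real p * sqrt (real p)))"
  using assms(1-4)
proof (induction P)
  case empty
  then show ?case by (simp add: has_mean_const_1)
next
  case (insert q P)
  have "has_mean (\<lambda>n. f q (multiplicity q n) * (\<Prod>p\<in>P. f p (multiplicity p n)))
     (pmean q (f q) * (\<Prod>p\<in>P. pmean p (f p)))
     ((\<bar>f q 0\<bar> + 2 * c / (real q * sqrt (real q))) * (\<Prod>p\<in>P. \<bar>f p 0\<bar> + 2 * c / (real p * sqrt (real p))))"
  proof (rule has_mean_prime_twist)
    fix n :: nat
    assume n: "n > 0"
    show "(\<Prod>p\<in>P. f p (multiplicity p (q * n))) = (\<Prod>p\<in>P. f p (multiplicity p n))"
    proof (rule prod.cong[OF refl])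
      fix p
      assume "p \<in> P"
      then have "prime p" "prime q" "p \<noteq> q"
        using insert by auto
      then show "f p (multiplicity p (q * n)) = f p (multiplicity p n)"
        using n by (simp add: prime_elem_multiplicity_mult_distrib prime_multiplicity_other prime_gt_0_nat)
    qed
  qed (use insert c in \<open>auto intro!: prod_nonneg\<close>)
  then show ?case
    using insert by simp
qed

lemma has_mean_prime:
  assumes "prime p" and "\<And>m. \<bar>f m\<bar> \<le> b"
    and "\<And>m. \<bar>f (Suc m) - f m\<bar> \<le> c / real p ^ Suc m"
  shows "has_mean (\<lambda>n. f (multiplicity p n)) (pmean p f) (\<bar>f 0\<bar> + 2 * c / (real p * sqrt (real p)))"
  using has_mean_prime_twist[OF assms(1) _ has_mean_const_1 _ assms(2,3)] by simp

subsection \<open>The abundancy index\<close>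

lemma hsum_0 [simp]: "hsum p 0 = 1"
  by (simp add: hsum_def)

lemma hsum_Suc: "hsum p (Suc m) = hsum p m + 1 / real p ^ Suc m"
  by (simp add: hsum_def)

lemma hsum_ge_1: "hsum p m \<ge> 1"
  by (induction m) (simp_all add: hsum_Suc add_increasing2)

lemma hsum_le_2:
  assumes "prime p"
  shows "hsum p m \<le> 2"
proof -
  have p2: "real p \<ge> 2"
    using prime_ge_2_nat[OF assms] by simp
  have "hsum p m + 1 / real p ^ m \<le> 2"
  proof (induction m)
    case (Suc m)
    have "2 / real p ^ Suc m \<le> 1 / real p ^ m"
      using p2 by (simp add: field_simps)
    then show ?case
      using Suc by (simp add: hsum_Suc)
  qed simp
  moreover have "1 / real p ^ m \<ge> 0"
    by simp
  ultimately show ?thesis by linarith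
qed

text \<open>This is sigma(n) / n, since d and n / d run through the same divisors.\<close>

definition abundancy :: "nat \<Rightarrow> real" where
  "abundancy n = (\<Sum>d | d dvd n. 1 / real d)"

lemma aliquot_abundancy:
  assumes "n > 0"
  shows "real (aliquot n) / real n = abundancy n - 1"
proof -
  have fin: "finite {d. d dvd n}"
    using assms by simp
  have "{d. d dvd n} = insert n {d. d dvd n \<and> d < n}"
    using assms by (auto dest: dvd_imp_le)
  then have "(\<Sum>d | d dvd n. real d) = real n + real (aliquot n)"
    using fin by (simp add: aliquot_def)
  moreover have "(\<Sum>d | d dvd n. real d / real n) = abundancy n"
    unfolding abundancy_def
    by (rule sum.reindex_bij_witness[of _ "\<lambda>d. n div d" "\<lambda>d. n div d"])
      (use assms in \<open>auto elim!: dvdE\<close>)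
  ultimately have "(real n + real (aliquot n)) / real n = abundancy n"
    by (metis sum_divide_distrib)
  then show ?thesis
    using assms by (simp add: field_simps)
qed

text \<open>Since p does not divide m, each divisor of p^k m is p^i d for exactly one i \<le> k and
  one d dividing m, so the divisor sum factors.\<close>

lemma abundancy_prime_power_mult:
  assumes p: "prime p" and m: "\<not> p dvd m"
  shows "abundancy (p ^ k * m) = hsum p k * abundancy m"
proof -
  have p0: "p > 0"
    using p by (simp add: prime_gt_0_nat)
  have mult: "multiplicity p (p ^ i * d) = i" if "d dvd m" for i d
    by (rule multiplicity_decomposeI[of _ _ _ d]) (use that m p0 in \<open>auto dest: dvd_trans\<close>)
  have inj: "inj_on (\<lambda>(i, d). p ^ i * d) ({0..k} \<times> {d. d dvd m})"
  proof (rule inj_onI, clarify, goal_cases)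
    case (1 i d i' d')
    then have "i = i'"
      using mult[of d i] mult[of d' i'] by simp
    then show ?case
      using 1 p0 by auto
  qed
  have "{d. d dvd p ^ k * m} = (\<lambda>(i, d). p ^ i * d) ` ({0..k} \<times> {d. d dvd m})"
  proof (intro equalityI subsetI)
    fix d
    assume "d \<in> {d. d dvd p ^ k * m}"
    then obtain a b where "d = a * b" "a dvd p ^ k" "b dvd m"
      using division_decomp by blast
    then show "d \<in> (\<lambda>(i, d). p ^ i * d) ` ({0..k} \<times> {d. d dvd m})"
      using divides_primepow_nat[OF p] by force
  qed (auto intro!: mult_dvd_mono le_imp_power_dvd)
  then have "abundancy (p ^ k * m) = (\<Sum>(i, d)\<in>{0..k} \<times> {d. d dvd m}. 1 / real p ^ i * (1 / real d))"
    unfolding abundancy_def by (simp only: sum.reindex[OF inj]) (simp add: case_prod_unfold)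
  also have "\<dots> = hsum p k * abundancy m"
    by (simp add: hsum_def abundancy_def sum_product sum.cartesian_product)
  finally show ?thesis .
qed

text \<open>\<open>P\<close> may contain primes not dividing n, which contribute
  \<open>hsum p 0 = 1\<close>; thus one set of primes can serve all n in a range at once. The
  induction splits off the full power of the inserted prime.\<close>

lemma abundancy_eq_prod:
  assumes "finite P" and "n > 0" and "prime_factors n \<subseteq> P" and "\<And>p. p \<in> P \<Longrightarrow> prime p"
  shows "abundancy n = (\<Prod>p\<in>P. hsum p (multiplicity p n))"
  using assms
proof (induction P arbitrary: n)
  case empty
  then have "n = 1"
    by (metis not_gr_zero prime_factorization_empty_iff set_mset_eq_empty_iff subset_empty nat_dvd_1_iff_1)
  then show ?case by (simp add: abundancy_def)
next
  case (insert q P)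
  obtain m where n: "n = q ^ multiplicity q n * m" and m: "\<not> q dvd m"
    by (rule multiplicity_decompose'[of n q]) (use insert.prems in \<open>auto simp: prime_nat_iff\<close>)
  have m0: "m > 0"
    using m by (cases m) auto
  have q: "prime q"
    using insert by simp
  have mult: "multiplicity p n = multiplicity p m" if "prime p" "p \<noteq> q" for p
  proof -
    have "multiplicity p n = multiplicity p (q ^ multiplicity q n) + multiplicity p m"
      using that q m0 by (subst n) (simp add: prime_elem_multiplicity_mult_distrib prime_gt_0_nat)
    then show ?thesis
      using that q by (simp add: prime_elem_multiplicity_power_distrib prime_multiplicity_other prime_gt_0_nat)
  qed
  have "prime_factors m \<subseteq> P"
  proof
    fix p
    assume p: "p \<in> prime_factors m"
    then have "p \<noteq> q"
      using m by auto
    moreover have "p \<in> prime_factors n"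
      using p \<open>p \<noteq> q\<close> by (auto simp: prime_factors_multiplicity mult)
    ultimately show "p \<in> P"
      using insert.prems(2) by blast
  qed
  then have "abundancy m = (\<Prod>p\<in>P. hsum p (multiplicity p m))"
    using insert m0 by simp
  also have "\<dots> = (\<Prod>p\<in>P. hsum p (multiplicity p n))"
    using insert.hyps insert.prems(3) by (intro prod.cong refl arg_cong[of _ _ "hsum _"] mult[symmetric]) auto
  finally have "abundancy (q ^ multiplicity q n * m) =
      hsum q (multiplicity q n) * (\<Prod>p\<in>P. hsum p (multiplicity p n))"
    using abundancy_prime_power_mult[OF q m] by simp
  then show ?case
    unfolding n[symmetric] using insert by simp
qed

text \<open>The local factor of the abundancy of \<open>2 n\<close> as a function of the multiplicity of \<open>p\<close> in \<open>n\<close>.\<close>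

definition shifted_hsum :: "nat \<Rightarrow> nat \<Rightarrow> real" where
  "shifted_hsum p m = hsum p (if p = 2 then Suc m else m)"

lemma shifted_hsum_ge_1: "shifted_hsum p m \<ge> 1"
  by (simp add: shifted_hsum_def hsum_ge_1)

lemma shifted_hsum_le_2: "prime p \<Longrightarrow> shifted_hsum p m \<le> 2"
  by (simp add: shifted_hsum_def hsum_le_2)

lemma shifted_hsum_Suc:
  "shifted_hsum p m \<le> shifted_hsum p (Suc m)"
  "shifted_hsum p (Suc m) - shifted_hsum p m \<le> 1 / real p ^ Suc m"
  by (auto simp: shifted_hsum_def hsum_Suc field_simps)

lemma abundancy_double_eq_prod:
  assumes n: "n > 0" and y: "2 * n \<le> y"
  shows "abundancy (2 * n) = (\<Prod>p | prime p \<and> p \<le> y. shifted_hsum p (multiplicity p n))"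
proof -
  have "prime_factors (2 * n) \<subseteq> {p. prime p \<and> p \<le> y}"
  proof
    fix p
    assume p: "p \<in> prime_factors (2 * n)"
    then have "p dvd 2 * n"
      by (rule in_prime_factors_imp_dvd)
    then have "p \<le> 2 * n"
      using n by (intro dvd_imp_le) auto
    then show "p \<in> {p. prime p \<and> p \<le> y}"
      using y p by auto
  qed
  then have "abundancy (2 * n) = (\<Prod>p | prime p \<and> p \<le> y. hsum p (multiplicity p (2 * n)))"
    using n by (intro abundancy_eq_prod) auto
  \<comment> \<open>Doubling n raises the multiplicity of 2 by one and no other, which is the shift
    built into \<open>shifted_hsum\<close>.\<close>
  also have "\<dots> = (\<Prod>p | prime p \<and> p \<le> y. shifted_hsum p (multiplicity p n))"
    using n by (intro prod.cong)
      (auto simp: shifted_hsum_def multiplicity_times_same prime_elem_multiplicity_mult_distrib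
        prime_multiplicity_other)
  finally show ?thesis .
qed

text \<open>The divisors 1 and 2 alone contribute 3/2. This keeps 1 / h(2n) at most 2/3, so the
  logarithm series converges geometrically, uniformly in n.\<close>

lemma abundancy_double_ge:
  assumes "n > 0"
  shows "abundancy (2 * n) \<ge> 3 / 2"
proof -
  have "(\<Sum>d\<in>{1, 2}. 1 / real d) \<le> abundancy (2 * n)"
    unfolding abundancy_def using assms by (intro sum_mono2) auto
  then show ?thesis by simp
qed

subsection \<open>Means of negative powers of the abundancy index\<close>

lemma summable_inverse_n_sqrt_n: "summable (\<lambda>n. 1 / (real n * sqrt (real n)))"
proof -
  have "1 / (real n * sqrt (real n)) = real n powr (- 3 / 2)" for n
  proof (cases "n = 0")
    case False
    then have "real n * sqrt (real n) = real n powr 1 * real n powr (1 / 2)"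
      by (simp add: powr_half_sqrt)
    also have "\<dots> = real n powr (3 / 2)"
      unfolding powr_add[symmetric] by simp
    finally show ?thesis
      by (simp add: powr_minus_divide)
  qed simp
  then show ?thesis
    by (simp add: summable_real_powr_iff)
qed

text \<open>A bound, uniform in the finite set of primes, for the sum of the local error terms with
  c = 1; the term n = 0 is 0 because division by zero gives 0.\<close>

definition err_const :: real where
  "err_const = (\<Sum>n. 2 / (real n * sqrt (real n)))"

lemma sum_le_err_const:
  "finite P \<Longrightarrow> (\<Sum>p\<in>P. 2 / (real p * sqrt (real p))) \<le> err_const"
  unfolding err_const_def
  using summable_mult[OF summable_inverse_n_sqrt_n, of 2] by (intro sum_le_suminf) auto

definition inv_pow :: "nat \<Rightarrow> nat \<Rightarrow> nat \<Rightarrow> real" where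
  "inv_pow j p m = 1 / shifted_hsum p m ^ j"

lemma abs_inv_pow_le_1: "\<bar>inv_pow j p m\<bar> \<le> 1"
  using shifted_hsum_ge_1[of p m] by (simp add: inv_pow_def field_simps)

lemma inv_pow_increment: "\<bar>inv_pow j p (Suc m) - inv_pow j p m\<bar> \<le> real j / real p ^ Suc m"
proof -
  let ?a = "shifted_hsum p m" and ?b = "shifted_hsum p (Suc m)"
  have ge: "?a \<ge> 1" "?b \<ge> 1" "?a \<le> ?b"
    by (simp_all add: shifted_hsum_ge_1 shifted_hsum_Suc)
  \<comment> \<open>On numbers of modulus at most 1, the j-th power is Lipschitz with constant j;
    this linear growth in j later becomes \<open>exp err_const ^ j\<close>.\<close>
  have "norm ((1 / ?b) ^ j - (1 / ?a) ^ j) \<le> real j * norm (1 / ?b - 1 / ?a)"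
    by (rule norm_power_diff) (use ge in auto)
  moreover have "norm (1 / ?b - 1 / ?a) \<le> 1 / real p ^ Suc m"
  proof -
    have "1 * 1 \<le> ?a * ?b"
      using ge by (intro mult_mono) auto
    then have "(?b - ?a) / (?a * ?b) \<le> (?b - ?a) / 1"
      using ge by (intro divide_left_mono) auto
    moreover have "1 / ?b - 1 / ?a = - ((?b - ?a) / (?a * ?b))"
      using ge by (simp add: field_simps)
    then have "norm (1 / ?b - 1 / ?a) = (?b - ?a) / (?a * ?b)"
      using ge by simp
    ultimately show ?thesis
      using shifted_hsum_Suc(2)[of p m] by (metis div_by_1 order_trans)
  qed
  then have "real j * norm (1 / ?b - 1 / ?a) \<le> real j * (1 / real p ^ Suc m)"
    by (intro mult_left_mono) auto
  ultimately show ?thesis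
    by (simp add: inv_pow_def power_one_over)
qed

lemma pmean_inv_pow: "p \<noteq> 2 \<Longrightarrow> pmean p (inv_pow j p) = beta j p"
  by (simp add: pmean_def beta_def inv_pow_def shifted_hsum_def)

text \<open>The shift at 2 drops the first term, which is 1, from the series of beta_j(2), and
  reindexing doubles the rest; the factor 1 - 1/2 cancels this doubling. This is the origin of 2
  beta_j(2) - 1.\<close>

lemma pmean_inv_pow_2: "pmean 2 (inv_pow j 2) = 2 * beta j 2 - 1"
proof -
  define a where "a m = 1 / 2 ^ m * (1 / hsum 2 m ^ j)" for m
  have "summable (\<lambda>m. (1 / 2) ^ m :: real)"
    by (rule summable_geometric) simp
  then have a: "summable a"
  proof (rule summable_comparison_test')
    fix m :: nat
    show "norm (a m) \<le> (1 / 2) ^ m"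
      using hsum_ge_1[of 2 m] by (simp add: a_def field_simps)
  qed
  then have "summable (\<lambda>m. a (Suc m))"
    by (simp add: summable_Suc_iff)
  then have "2 * (\<Sum>m. a (Suc m)) = (\<Sum>m. 2 * a (Suc m))"
    by (rule suminf_mult[symmetric])
  also have "(\<lambda>m. 2 * a (Suc m)) = (\<lambda>m. 1 / 2 ^ m * inv_pow j 2 m)"
    by (auto simp: a_def inv_pow_def shifted_hsum_def)
  finally have "pmean 2 (inv_pow j 2) = (\<Sum>m. a (Suc m))"
    by (simp add: pmean_def)
  also have "\<dots> = suminf a - 1"
    using suminf_split_head[OF a] by (simp add: a_def)
  also have "suminf a = 2 * beta j 2"
    by (simp add: beta_def a_def[abs_def])
  finally show ?thesis .
qed

definition euler_mean :: "nat \<Rightarrow> real" where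
  "euler_mean j = (2 * beta j 2 - 1) * (\<Prod>p. if prime p \<and> p \<ge> 3 then beta j p else 1)"

lemma LIMSEQ_prod_pmean:
  "(\<lambda>y. \<Prod>p | prime p \<and> p \<le> y. pmean p (inv_pow j p)) \<longlonglongrightarrow> euler_mean j"
proof -
  let ?g = "\<lambda>p. if prime p \<and> p \<ge> 3 then beta j p else 1"
  \<comment> \<open>For odd primes \<open>inv_pow j p 0 = 1\<close>, so the local means are 1 + O(j
    / p^2) and the Euler product converges absolutely.\<close>
  have bound: "norm (norm (?g p - 1)) \<le> 2 * real j * (1 / (real p)\<^sup>2)" for p
  proof (cases "prime p \<and> p \<ge> 3")
    case True
    then have "\<bar>pmean p (inv_pow j p) - inv_pow j p 0\<bar> \<le> 2 * real j / (real p)\<^sup>2"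
      by (intro pmean_diff_bound[where b = 1] abs_inv_pow_le_1 inv_pow_increment) auto
    moreover have "inv_pow j p 0 = 1"
      using True by (simp add: inv_pow_def shifted_hsum_def)
    ultimately show ?thesis
      using True by (simp add: pmean_inv_pow)
  qed auto
  have "summable (\<lambda>p. 2 * real j * (1 / (real p)\<^sup>2))"
    using inverse_power_summable[of 2, where 'a = real]
    by (intro summable_mult) (simp add: field_simps)
  then have "summable (\<lambda>p. norm (?g p - 1))"
    by (rule summable_comparison_test') (rule bound)
  then have "convergent_prod ?g"
    by (intro abs_convergent_prod_imp_convergent_prod summable_imp_abs_convergent_prod)
  then have "(\<lambda>y. \<Prod>p\<le>y. ?g p) \<longlonglongrightarrow> prodinf ?g"
    by (rule convergent_prod_LIMSEQ)
  then have lim: "(\<lambda>y. (2 * beta j 2 - 1) * (\<Prod>p\<le>y. ?g p)) \<longlonglongrightarrow> euler_mean j"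
    unfolding euler_mean_def by (intro tendsto_intros)
  have eq: "(\<Prod>p | prime p \<and> p \<le> y. pmean p (inv_pow j p)) = (2 * beta j 2 - 1) * (\<Prod>p\<le>y. ?g p)"
    if "y \<ge> 2" for y
  proof -
    have "{p. prime p \<and> p \<le> y} = insert 2 {p. prime p \<and> p \<le> y \<and> p \<ge> 3}"
      using that by (auto dest: prime_ge_2_nat)
    then have "(\<Prod>p | prime p \<and> p \<le> y. pmean p (inv_pow j p)) =
        pmean 2 (inv_pow j 2) * (\<Prod>p | prime p \<and> p \<le> y \<and> p \<ge> 3. pmean p (inv_pow j p))"
      by simp
    also have "(\<Prod>p | prime p \<and> p \<le> y \<and> p \<ge> 3. pmean p (inv_pow j p)) = (\<Prod>p\<le>y. ?g p)"
      by (rule prod.mono_neutral_cong_left) (auto simp: pmean_inv_pow)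
    finally show ?thesis
      by (simp add: pmean_inv_pow_2)
  qed
  have "eventually (\<lambda>y. (2 * beta j 2 - 1) * (\<Prod>p\<le>y. ?g p) =
          (\<Prod>p | prime p \<and> p \<le> y. pmean p (inv_pow j p))) sequentially"
    using eventually_ge_at_top[of 2] by eventually_elim (simp only: eq)
  from Lim_transform_eventually[OF lim this] show ?thesis .
qed

text \<open>For y \<ge> 2N the product over primes up to y is exactly the summand for all n \<le> N,
  and the error constant is bounded independently of y, so y may tend to infinity with N
  fixed.\<close>

lemma euler_mean_error:
  "\<bar>(\<Sum>n=1..N. 1 / abundancy (2 * n) ^ j) - real N * euler_mean j\<bar> \<le> exp err_const ^ j * sqrt (real N)"
proof -
  let ?P = "\<lambda>y. {p. prime p \<and> p \<le> (y::nat)}"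
  let ?S = "\<Sum>n=1..N. 1 / abundancy (2 * n) ^ j"
  have "\<bar>?S - real N * (\<Prod>p\<in>?P y. pmean p (inv_pow j p))\<bar> \<le> exp err_const ^ j * sqrt (real N)"
    if y: "y \<ge> 2 * N" for y
  proof -
    let ?C = "\<Prod>p\<in>?P y. \<bar>inv_pow j p 0\<bar> + 2 * real j / (real p * sqrt (real p))"
    have "has_mean (\<lambda>n. \<Prod>p\<in>?P y. inv_pow j p (multiplicity p n))
        (\<Prod>p\<in>?P y. pmean p (inv_pow j p)) ?C"
      by (intro has_mean_prod[where b = 1] abs_inv_pow_le_1 inv_pow_increment) auto
    then have "\<bar>summatory (\<lambda>n. \<Prod>p\<in>?P y. inv_pow j p (multiplicity p n)) (real N)
        - real N * (\<Prod>p\<in>?P y. pmean p (inv_pow j p))\<bar> \<le> ?C * sqrt (real N)"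
      unfolding has_mean_def by auto
    moreover have "summatory (\<lambda>n. \<Prod>p\<in>?P y. inv_pow j p (multiplicity p n)) (real N) = ?S"
      unfolding summatory_of_nat using y
      by (intro sum.cong) (auto simp: abundancy_double_eq_prod[of _ y] inv_pow_def prod_dividef prod_power_distrib)
    \<comment> \<open>By 1 + t \<le> exp t, the product over primes is at most \<open>exp\<close> of
      j times a partial sum of a convergent series.\<close>
    moreover have "?C \<le> exp err_const ^ j"
    proof -
      have "?C \<le> (\<Prod>p\<in>?P y. 1 + real j * (2 / (real p * sqrt (real p))))"
        using abs_inv_pow_le_1[of j] by (intro prod_mono) (auto simp: mult.commute)
      also have "\<dots> \<le> exp (\<Sum>p\<in>?P y. real j * (2 / (real p * sqrt (real p))))"
        by (rule prod_le_exp_sum) auto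
      also have "\<dots> \<le> exp (real j * err_const)"
        unfolding sum_distrib_left[symmetric] exp_le_cancel_iff
        by (intro mult_left_mono sum_le_err_const) auto
      finally show ?thesis
        by (simp add: exp_of_nat_mult)
    qed
    ultimately show ?thesis
      by (smt (verit) mult_right_mono real_sqrt_ge_zero of_nat_0_le_iff)
  qed
  moreover have "(\<lambda>y. \<bar>?S - real N * (\<Prod>p\<in>?P y. pmean p (inv_pow j p))\<bar>) \<longlonglongrightarrow> \<bar>?S - real N * euler_mean j\<bar>"
    by (intro tendsto_intros LIMSEQ_prod_pmean)
  ultimately show ?thesis
    by (intro LIMSEQ_le_const2) blast+
qed

subsection \<open>The logarithmic mean\<close>

definition log_hsum :: "nat \<Rightarrow> nat \<Rightarrow> real" where
  "log_hsum p m = ln (shifted_hsum p m)"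

lemma log_hsum_bounds:
  assumes "prime p"
  shows "0 \<le> log_hsum p m" "\<bar>log_hsum p m\<bar> \<le> 1"
proof -
  show "0 \<le> log_hsum p m"
    using shifted_hsum_ge_1[of p m] by (simp add: log_hsum_def)
  moreover have "log_hsum p m \<le> shifted_hsum p m - 1"
    unfolding log_hsum_def using shifted_hsum_ge_1[of p m] by (intro ln_le_minus_one) simp
  ultimately show "\<bar>log_hsum p m\<bar> \<le> 1"
    using shifted_hsum_le_2[OF assms, of m] by simp
qed

lemma log_hsum_increment: "\<bar>log_hsum p (Suc m) - log_hsum p m\<bar> \<le> 1 / real p ^ Suc m"
proof -
  let ?a = "shifted_hsum p m" and ?b = "shifted_hsum p (Suc m)"
  have ge: "?a \<ge> 1" "?b \<ge> 1" "?a \<le> ?b"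
    by (simp_all add: shifted_hsum_ge_1 shifted_hsum_Suc)
  have "ln ?b - ln ?a \<le> (?b - ?a) / ?a"
    using ge by (intro ln_diff_le) auto
  also have "\<dots> \<le> (?b - ?a) / 1"
    using ge by (intro divide_left_mono) auto
  also have "\<dots> \<le> 1 / real p ^ Suc m"
    using shifted_hsum_Suc(2)[of p m] by simp
  finally show ?thesis
    using ge by (simp add: log_hsum_def)
qed

text \<open>For odd p the term m = 0 is ln 1 = 0, so the series starts at m = 1 as in
  \<open>alpha\<close>. At 2 the shift moves the indices up by one and thereby doubles the mean,
  which accounts for the extra \<open>alpha 2\<close> in the constant.\<close>

lemma pmean_log_hsum:
  assumes p: "prime p"
  shows "pmean p (log_hsum p) = (if p = 2 then 2 * alpha 2 else alpha p)"
proof -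
  have p2: "real p \<ge> 2"
    using prime_ge_2_nat[OF p] by simp
  have "summable (\<lambda>m. (1 / real p) ^ m)"
    using p2 by (intro summable_geometric) auto
  then have summ: "summable (\<lambda>m. 1 / real p ^ m * log_hsum p m)"
  proof (rule summable_comparison_test')
    fix m :: nat
    show "norm (1 / real p ^ m * log_hsum p m) \<le> (1 / real p) ^ m"
      using log_hsum_bounds[OF p, of m] p2 by (simp add: abs_mult field_simps)
  qed
  show ?thesis
  proof (cases "p = 2")
    case True
    have "(\<Sum>m. 1 / 2 * (1 / real p ^ m * log_hsum p m)) = 1 / 2 * (\<Sum>m. 1 / real p ^ m * log_hsum p m)"
      by (rule suminf_mult[OF summ])
    moreover have "(\<lambda>m. 1 / 2 * (1 / real p ^ m * log_hsum p m)) = (\<lambda>m. 1 / 2 ^ Suc m * ln (hsum 2 (Suc m)))"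
      using True by (auto simp: log_hsum_def shifted_hsum_def)
    ultimately show ?thesis
      using True by (simp only: pmean_def alpha_def) simp
  next
    case False
    then show ?thesis
      using suminf_split_head[OF summ] by (simp add: pmean_def alpha_def log_hsum_def shifted_hsum_def)
  qed
qed

definition log_mean :: real where
  "log_mean = alpha 2 + (\<Sum>\<^sub>\<infinity>p\<in>{p::nat. prime p}. alpha p)"

lemma LIMSEQ_sum_pmean:
  "(\<lambda>y. \<Sum>p | prime p \<and> p \<le> y. pmean p (log_hsum p)) \<longlonglongrightarrow> log_mean"
proof -
  let ?g = "\<lambda>p. if prime p then alpha p else 0"
  \<comment> \<open>For primes p \<ge> 3, \<open>log_hsum p 0 = 0\<close>, so the bound on the
    deviation from that value bounds \<open>alpha p\<close> itself; at 2 the value is ln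
    (3/2).\<close>
  have bound: "norm (?g p) \<le> 2 / (real p)\<^sup>2" if "p \<ge> 3" for p
  proof (cases "prime p")
    case True
    then have "\<bar>pmean p (log_hsum p) - log_hsum p 0\<bar> \<le> 2 * 1 / (real p)\<^sup>2"
      by (intro pmean_diff_bound[where b = 1] log_hsum_bounds log_hsum_increment)
    then show ?thesis
      using True that by (simp add: pmean_log_hsum log_hsum_def shifted_hsum_def)
  qed auto
  have "summable (\<lambda>p. 2 * (1 / (real p)\<^sup>2))"
    using inverse_power_summable[of 2, where 'a = real]
    by (intro summable_mult) (simp add: field_simps)
  then have summ: "summable (\<lambda>p. norm (?g p))"
    by (rule summable_comparison_test'[where N = 3]) (use bound in auto)
  \<comment> \<open>Absolute summability identifies the unordered sum over primes with the limit of
    its ordered partial sums.\<close>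
  then have "(?g has_sum suminf ?g) UNIV"
    by (intro norm_summable_imp_has_sum summable_sums summable_norm_cancel[OF summ])
  then have "(alpha has_sum suminf ?g) {p. prime p}"
    by (subst (asm) has_sum_cong_neutral[where T = "{p. prime p}" and g = alpha]) auto
  then have "infsum alpha {p. prime p} = suminf ?g"
    by (rule infsumI)
  moreover have "(\<lambda>y. \<Sum>p\<le>y. ?g p) \<longlonglongrightarrow> suminf ?g"
    by (intro summable_LIMSEQ' summable_norm_cancel[OF summ])
  ultimately have lim: "(\<lambda>y. alpha 2 + (\<Sum>p\<le>y. ?g p)) \<longlonglongrightarrow> log_mean"
    unfolding log_mean_def by (intro tendsto_intros) simp
  have eq: "(\<Sum>p | prime p \<and> p \<le> y. pmean p (log_hsum p)) = alpha 2 + (\<Sum>p\<le>y. ?g p)"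
    if "y \<ge> 2" for y
  proof -
    have "(\<Sum>p | prime p \<and> p \<le> y. pmean p (log_hsum p)) =
        (\<Sum>p | prime p \<and> p \<le> y. (if p = 2 then alpha 2 else 0) + alpha p)"
      by (intro sum.cong) (auto simp: pmean_log_hsum)
    also have "\<dots> = alpha 2 + (\<Sum>p | prime p \<and> p \<le> y. alpha p)"
      using that by (simp add: sum.distrib sum.delta)
    also have "(\<Sum>p | prime p \<and> p \<le> y. alpha p) = (\<Sum>p\<le>y. ?g p)"
      by (rule sum.mono_neutral_cong_left) auto
    finally show ?thesis .
  qed
  have "eventually (\<lambda>y. alpha 2 + (\<Sum>p\<le>y. ?g p) = (\<Sum>p | prime p \<and> p \<le> y. pmean p (log_hsum p)))
          sequentially"
    using eventually_ge_at_top[of 2] by eventually_elim (simp only: eq)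
  from Lim_transform_eventually[OF lim this] show ?thesis .
qed

text \<open>ln h(2n) is a sum over primes, so the one-prime estimates simply add; y again tends to
  infinity once the error is bounded independently of y.\<close>

lemma log_mean_error:
  "\<bar>(\<Sum>n=1..N. ln (abundancy (2 * n))) - real N * log_mean\<bar> \<le> (1 + err_const) * sqrt (real N)"
proof -
  let ?P = "\<lambda>y. {p. prime p \<and> p \<le> (y::nat)}"
  let ?S = "\<Sum>n=1..N. ln (abundancy (2 * n))"
  have "\<bar>?S - real N * (\<Sum>p\<in>?P y. pmean p (log_hsum p))\<bar> \<le> (1 + err_const) * sqrt (real N)"
    if y: "y \<ge> 2 * N" for y
  proof -
    let ?s = "\<lambda>p. summatory (\<lambda>n. log_hsum p (multiplicity p n)) (real N)"
    let ?C = "\<lambda>p. \<bar>log_hsum p 0\<bar> + 2 * 1 / (real p * sqrt (real p))"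
    have "\<bar>?s p - real N * pmean p (log_hsum p)\<bar> \<le> ?C p * sqrt (real N)" if "p \<in> ?P y" for p
    proof -
      have "has_mean (\<lambda>n. log_hsum p (multiplicity p n)) (pmean p (log_hsum p)) (?C p)"
        using that by (intro has_mean_prime[where b = 1] log_hsum_bounds log_hsum_increment) auto
      then show ?thesis
        unfolding has_mean_def by auto
    qed
    then have "\<bar>\<Sum>p\<in>?P y. ?s p - real N * pmean p (log_hsum p)\<bar> \<le> (\<Sum>p\<in>?P y. ?C p * sqrt (real N))"
      by (intro order_trans[OF sum_abs sum_mono])
    also have "\<dots> = (\<Sum>p\<in>?P y. ?C p) * sqrt (real N)"
      by (simp add: sum_distrib_right)
    also have "\<dots> \<le> (1 + err_const) * sqrt (real N)"
    proof (rule mult_right_mono)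
      \<comment> \<open>\<open>log_hsum p 0\<close> vanishes for odd primes and is at most 1 at 2;
        what remains is summable over primes.\<close>
      have "(\<Sum>p\<in>?P y. ?C p) \<le>
          (\<Sum>p\<in>?P y. (if p = 2 then 1 else 0) + 2 / (real p * sqrt (real p)))"
        using log_hsum_bounds(2)[of 2 0]
        by (intro sum_mono) (auto simp: log_hsum_def shifted_hsum_def)
      also have "\<dots> \<le> 1 + err_const"
        unfolding sum.distrib by (intro add_mono sum_le_err_const) (auto simp: sum.delta)
      finally show "(\<Sum>p\<in>?P y. ?C p) \<le> 1 + err_const" .
    qed simp
    finally have "\<bar>(\<Sum>p\<in>?P y. ?s p) - real N * (\<Sum>p\<in>?P y. pmean p (log_hsum p))\<bar>
        \<le> (1 + err_const) * sqrt (real N)"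
      by (simp add: sum_subtractf sum_distrib_left)
    moreover have "(\<Sum>p\<in>?P y. ?s p) = ?S"
    proof -
      have "(\<Sum>p\<in>?P y. ?s p) = (\<Sum>n=1..N. \<Sum>p\<in>?P y. log_hsum p (multiplicity p n))"
        unfolding summatory_of_nat by (rule sum.swap)
      also have "\<dots> = ?S"
      proof (rule sum.cong[OF refl])
        fix n
        assume "n \<in> {1..N}"
        then have "abundancy (2 * n) = (\<Prod>p\<in>?P y. shifted_hsum p (multiplicity p n))"
          using y by (intro abundancy_double_eq_prod) auto
        moreover have "shifted_hsum p (multiplicity p n) \<noteq> 0" for p
          using shifted_hsum_ge_1[of p "multiplicity p n"] by linarith
        ultimately show "(\<Sum>p\<in>?P y. log_hsum p (multiplicity p n)) = ln (abundancy (2 * n))"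
          by (simp add: log_hsum_def) (subst ln_prod, auto)
      qed
      finally show ?thesis .
    qed
    ultimately show ?thesis by simp
  qed
  moreover have "(\<lambda>y. \<bar>?S - real N * (\<Sum>p\<in>?P y. pmean p (log_hsum p))\<bar>) \<longlonglongrightarrow> \<bar>?S - real N * log_mean\<bar>"
    by (intro tendsto_intros LIMSEQ_sum_pmean)
  ultimately show ?thesis
    by (intro LIMSEQ_le_const2) blast+
qed

subsection \<open>Summation over the powers\<close>

definition avg_pow :: "nat \<Rightarrow> nat \<Rightarrow> real" where
  "avg_pow N j = (1 / real N) * (\<Sum>n=1..N. 1 / abundancy (2 * n) ^ j)"

lemma avg_pow_bounds: "0 \<le> avg_pow N j" "avg_pow N j \<le> (2 / 3) ^ j"
proof -
  have pos: "abundancy n \<ge> 0" for n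
    by (auto simp: abundancy_def intro: sum_nonneg)
  then show "0 \<le> avg_pow N j"
    unfolding avg_pow_def by (intro mult_nonneg_nonneg sum_nonneg) auto
  have "1 / abundancy (2 * n) ^ j \<le> (2 / 3) ^ j" if "n \<in> {1..N}" for n
  proof -
    have "1 / abundancy (2 * n) \<le> 1 / (3 / 2)"
      using abundancy_double_ge[of n] that by (intro divide_left_mono) auto
    then have "(1 / abundancy (2 * n)) ^ j \<le> (2 / 3) ^ j"
      using pos by (intro power_mono) auto
    then show ?thesis
      by (simp add: power_one_over)
  qed
  then have "(\<Sum>n=1..N. 1 / abundancy (2 * n) ^ j) \<le> real (card {1..N}) * (2 / 3) ^ j"
    by (rule sum_bounded_above)
  then show "avg_pow N j \<le> (2 / 3) ^ j"
    by (cases "N = 0") (auto simp: avg_pow_def field_simps)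
qed

lemma avg_pow_error:
  assumes "N > 0"
  shows "\<bar>avg_pow N j - euler_mean j\<bar> \<le> exp err_const ^ j / sqrt (real N)"
proof -
  have "avg_pow N j - euler_mean j =
      ((\<Sum>n=1..N. 1 / abundancy (2 * n) ^ j) - real N * euler_mean j) / real N"
    using assms by (simp add: avg_pow_def field_simps)
  also have "\<bar>\<dots>\<bar> \<le> exp err_const ^ j * sqrt (real N) / real N"
    unfolding abs_divide using euler_mean_error[where N = N and j = j] by (simp add: divide_right_mono)
  also have "\<dots> = exp err_const ^ j / sqrt (real N)"
    using assms by (simp add: field_simps)
  finally show ?thesis .
qed

text \<open>At fixed j, letting N tend to infinity in \<open>avg_pow_error\<close> makes
  \<open>euler_mean j\<close> the limit of the averages, so it inherits their bounds.\<close>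

lemma euler_mean_bounds: "0 \<le> euler_mean j" "euler_mean j \<le> (2 / 3) ^ j"
proof -
  have "(\<lambda>N. exp err_const ^ j / sqrt (real N)) \<longlonglongrightarrow> 0"
    by (intro tendsto_divide_0[OF tendsto_const] filterlim_at_top_imp_at_infinity
        filterlim_compose[OF sqrt_at_top filterlim_real_sequentially])
  then have "(\<lambda>N. avg_pow N j - euler_mean j) \<longlonglongrightarrow> 0"
    by (rule Lim_null_comparison[rotated])
      (use eventually_gt_at_top[of 0] in \<open>eventually_elim, simp add: avg_pow_error\<close>)
  then have lim: "(\<lambda>N. avg_pow N j) \<longlonglongrightarrow> euler_mean j"
    by (simp add: LIM_zero_iff)
  show "0 \<le> euler_mean j"
    by (rule LIMSEQ_le_const[OF lim]) (auto simp: avg_pow_bounds)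
  show "euler_mean j \<le> (2 / 3) ^ j"
    by (rule LIMSEQ_le_const2[OF lim]) (auto simp: avg_pow_bounds)
qed

lemma min_le_powr_interpolation:
  fixes a b :: real
  assumes "x \<le> a" "x \<le> b" "0 \<le> x" "0 < a" "0 < b" "0 \<le> t" "t \<le> 1"
  shows "x \<le> a powr t * b powr (1 - t)"
proof (cases "x = 0")
  case False
  then have "x = x powr t * x powr (1 - t)"
    using assms by (simp flip: powr_add)
  also have "\<dots> \<le> a powr t * b powr (1 - t)"
    using assms by (intro mult_mono powr_mono2) auto
  finally show ?thesis .
qed (use assms in auto)

lemma avg_pow_uniform_error:
  obtains \<theta> :: real where "\<theta> > 0"
    "\<And>N j. N > 0 \<Longrightarrow> \<bar>avg_pow N j - euler_mean j\<bar> \<le> real N powr (- \<theta>) * (5 / 6) ^ j"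
proof -
  define K where "K = exp err_const"
  have "0 \<le> err_const"
    using sum_le_err_const[of "{}"] by simp
  then have K: "K \<ge> 1"
    by (simp add: K_def)
  \<comment> \<open>Chosen so that (3K/2)^t = 5/4, hence K^t (2/3)^(1-t) = (2/3)(5/4) = 5/6: the
    weighted geometric mean of K^j / sqrt N and (2/3)^j then decays like (5/6)^j. From K \<ge> 1
    follows 3K/2 \<ge> 5/4, so t \<le> 1.\<close>
  define t where "t = ln (5 / 4) / ln (3 * K / 2)"
  have ln54: "ln (5 / 4 :: real) > 0"
    by (rule ln_gt_zero) simp
  have lnK: "ln (3 * K / 2) \<ge> ln (5 / 4)"
    using K by simp
  then have lnK_pos: "ln (3 * K / 2) > 0"
    using ln54 by linarith
  then have t: "0 < t" "t \<le> 1"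
    unfolding t_def using ln54 lnK by (simp_all only: divide_pos_pos divide_le_eq_1_pos)
  have "(3 * K / 2) powr t = exp (t * ln (3 * K / 2))"
    using K by (simp add: powr_def)
  also have "t * ln (3 * K / 2) = ln (5 / 4)"
    using lnK_pos by (simp add: t_def)
  finally have Kt: "(3 * K / 2) powr t = 5 / 4"
    by simp
  have base: "K powr t * (2 / 3) powr (1 - t) = 5 / 6"
  proof -
    have "K powr t = (3 * K / 2) powr t * (2 / 3) powr t"
      using K by (simp flip: powr_mult)
    then have "K powr t * (2 / 3) powr (1 - t) = (3 * K / 2) powr t * ((2 / 3) powr t * (2 / 3) powr (1 - t))"
      by simp
    also have "\<dots> = 5 / 6"
      unfolding Kt powr_add[symmetric] by simp
    finally show ?thesis .
  qed
  show ?thesis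
  \<comment> \<open>The saving is sqrt N to the power -t, that is N to the power -t/2.\<close>
  proof (rule that[of "t / 2"])
    fix N j :: nat
    assume N: "N > 0"
    have swap: "(a ^ j) powr s = (a powr s) ^ j" if "a > 0" for a s :: real
      using that by (simp add: powr_powr mult.commute flip: powr_realpow)
    have "\<bar>avg_pow N j - euler_mean j\<bar> \<le> (K ^ j / sqrt (real N)) powr t * ((2 / 3) ^ j) powr (1 - t)"
    proof (rule min_le_powr_interpolation)
      show "\<bar>avg_pow N j - euler_mean j\<bar> \<le> K ^ j / sqrt (real N)"
        using avg_pow_error[OF N] by (simp add: K_def)
      show "\<bar>avg_pow N j - euler_mean j\<bar> \<le> (2 / 3) ^ j"
        using avg_pow_bounds[of N j] euler_mean_bounds[of j] by linarith
    qed (use K N t in auto)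
    also have "\<dots> = (K powr t) ^ j * ((2 / 3) powr (1 - t)) ^ j * sqrt (real N) powr (- t)"
      using K swap[of K t] swap[of "2 / 3" "1 - t"]
      by (simp only: powr_divide[of "K ^ j"] powr_minus_divide) simp
    also have "\<dots> = real N powr (- (t / 2)) * (5 / 6) ^ j"
      by (simp add: power_mult_distrib[symmetric] base powr_half_sqrt[symmetric] powr_powr)
    finally show "\<bar>avg_pow N j - euler_mean j\<bar> \<le> real N powr (- (t / 2)) * (5 / 6) ^ j" .
  qed (use t in auto)
qed

section \<open>Series expansion of the logarithm and the final estimate\<close>

lemma ln_one_minus_sums:
  fixes x :: real
  assumes "0 \<le> x" "x < 1"
  shows "(\<lambda>j. - (1 / real (Suc j) * x ^ Suc j)) sums ln (1 - x)"
proof -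
  have "(\<lambda>n. - ((- (- x)) ^ n) / real n) sums ln (1 + (- x))"
    by (rule ln_series') (use assms in auto)
  then show ?thesis
    using sums_Suc_iff[of "\<lambda>n. - ((- (- x)) ^ n) / real n" "ln (1 - x)"] by simp
qed

text \<open>Factoring h - 1 = h (1 - 1/h) splits the logarithm, and the series of ln (1 - 1/h) in
  powers of 1/h is added over the finitely many n, turning each power into an average
  \<open>avg_pow\<close>.\<close>

lemma ln_aliquot_ratio_avg:
  assumes "N > 0"
  shows "(1 / real N) * (\<Sum>n=1..N. ln (real (aliquot (2 * n)) / real (2 * n))) =
    (1 / real N) * (\<Sum>n=1..N. ln (abundancy (2 * n))) - (\<Sum>j. 1 / real (Suc j) * avg_pow N (Suc j))"
    and "summable (\<lambda>j. 1 / real (Suc j) * avg_pow N (Suc j))"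
proof -
  have split: "ln (real (aliquot (2 * n)) / real (2 * n)) =
      ln (abundancy (2 * n)) + ln (1 - 1 / abundancy (2 * n))" if "n \<in> {1..N}" for n
  proof -
    have ge: "abundancy (2 * n) \<ge> 3 / 2"
      using that by (intro abundancy_double_ge) auto
    have "real (aliquot (2 * n)) / real (2 * n) = abundancy (2 * n) - 1"
      using that by (intro aliquot_abundancy) auto
    also have "\<dots> = abundancy (2 * n) * (1 - 1 / abundancy (2 * n))"
      using ge by (simp add: field_simps)
    finally show ?thesis
      using ge by (simp only:) (rule ln_mult_pos, auto)
  qed
  have "(\<lambda>j. \<Sum>n=1..N. - (1 / real (Suc j) * (1 / abundancy (2 * n)) ^ Suc j)) sums
      (\<Sum>n=1..N. ln (1 - 1 / abundancy (2 * n)))"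
  proof (rule sums_sum)
    fix n
    assume "n \<in> {1..N}"
    then have "abundancy (2 * n) \<ge> 3 / 2"
      by (intro abundancy_double_ge) auto
    then show "(\<lambda>j. - (1 / real (Suc j) * (1 / abundancy (2 * n)) ^ Suc j)) sums ln (1 - 1 / abundancy (2 * n))"
      by (intro ln_one_minus_sums) auto
  qed
  from sums_mult[OF this, of "- (1 / real N)"]
  have sums: "(\<lambda>j. 1 / real (Suc j) * avg_pow N (Suc j)) sums
      (- (1 / real N) * (\<Sum>n=1..N. ln (1 - 1 / abundancy (2 * n))))"
    by (simp add: avg_pow_def sum_negf sum_distrib_left power_one_over mult_ac)
  then show "summable (\<lambda>j. 1 / real (Suc j) * avg_pow N (Suc j))"
    by (rule sums_summable)
  have "(\<Sum>n=1..N. ln (real (aliquot (2 * n)) / real (2 * n))) =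
      (\<Sum>n=1..N. ln (abundancy (2 * n)) + ln (1 - 1 / abundancy (2 * n)))"
    by (rule sum.cong[OF refl split])
  then show "(1 / real N) * (\<Sum>n=1..N. ln (real (aliquot (2 * n)) / real (2 * n))) =
    (1 / real N) * (\<Sum>n=1..N. ln (abundancy (2 * n))) - (\<Sum>j. 1 / real (Suc j) * avg_pow N (Suc j))"
    unfolding sums_unique[OF sums, symmetric] by (simp add: sum.distrib distrib_left)
qed

text \<open>From ln x \<le> x^a / a; this weakens every power saving to the rate 1 / ln N.\<close>

lemma powr_neg_le_inverse_ln:
  fixes x :: real
  assumes "x > 1" "a > 0"
  shows "x powr (- a) \<le> (1 / a) * (1 / ln x)"
  using ln_powr_bound[of x a] assms by (simp add: powr_minus field_simps)

theorem theorem3p3: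
  shows "(\<lambda>N::nat. (1 / real N) * (\<Sum>n=1..N. ln (real (aliquot (2*n)) / real (2*n)))
            - lambda_const) \<in> O(\<lambda>N. 1 / ln (real N))"
proof -
  obtain \<theta> :: real where \<theta>: "\<theta> > 0"
    and err: "\<And>N j. N > 0 \<Longrightarrow> \<bar>avg_pow N j - euler_mean j\<bar> \<le> real N powr (- \<theta>) * (5 / 6) ^ j"
    using avg_pow_uniform_error by blast
  have geo: "summable (\<lambda>j. (r::real) ^ Suc j)" if "\<bar>r\<bar> < 1" for r
    unfolding summable_Suc_iff by (rule summable_geometric) (use that in auto)
  have "summable (\<lambda>j. 1 / real (Suc j) * euler_mean (Suc j))"
  proof (rule summable_comparison_test'[OF geo[of "2 / 3"]])
    fix j
    have "1 / real (Suc j) * euler_mean (Suc j) \<le> 1 * (2 / 3) ^ Suc j"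
      using euler_mean_bounds[of "Suc j"] by (intro mult_mono) auto
    then show "norm (1 / real (Suc j) * euler_mean (Suc j)) \<le> (2 / 3) ^ Suc j"
      using euler_mean_bounds[of "Suc j"] by simp
  qed simp
  note summ = ln_aliquot_ratio_avg(2) this
  have lambda: "lambda_const = log_mean - (\<Sum>j. 1 / real (Suc j) * euler_mean (Suc j))"
    by (simp add: lambda_const_def log_mean_def euler_mean_def)
  define D where "D = (\<Sum>j. (5 / 6 :: real) ^ Suc j)"
  have D: "D \<ge> 0"
    unfolding D_def by (intro suminf_nonneg geo) auto
  have E: "err_const \<ge> 0"
    using sum_le_err_const[of "{}"] by simp
  have pow_part: "\<bar>(\<Sum>j. 1 / real (Suc j) * avg_pow N (Suc j)) - (\<Sum>j. 1 / real (Suc j) * euler_mean (Suc j))\<bar>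
      \<le> real N powr (- \<theta>) * D" if N: "N > 0" for N
  proof -
    let ?d = "\<lambda>j. 1 / real (Suc j) * avg_pow N (Suc j) - 1 / real (Suc j) * euler_mean (Suc j)"
    have le: "norm (?d j) \<le> real N powr (- \<theta>) * (5 / 6) ^ Suc j" for j
    proof -
      have "norm (?d j) = 1 / real (Suc j) * \<bar>avg_pow N (Suc j) - euler_mean (Suc j)\<bar>"
        by (simp only: right_diff_distrib[symmetric] real_norm_def abs_mult) simp
      \<comment> \<open>The weight 1 / (j + 1) is bounded by 1, since (5/6)^(j+1) already secures
        convergence.\<close>
      also have "\<dots> \<le> 1 * (real N powr (- \<theta>) * (5 / 6) ^ Suc j)"
        by (intro mult_mono err N) auto
      finally show ?thesis by simp
    qed
    have summ': "summable (\<lambda>j. real N powr (- \<theta>) * (5 / 6) ^ Suc j)"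
      by (intro summable_mult geo) auto
    have "norm (suminf ?d) \<le> (\<Sum>j. real N powr (- \<theta>) * (5 / 6) ^ Suc j)"
      by (rule norm_suminf_le[OF le summ'])
    also have "\<dots> = real N powr (- \<theta>) * D"
      unfolding D_def by (intro suminf_mult geo) auto
    finally show ?thesis
      using summ(1)[OF N] summ(2) by (simp add: suminf_diff)
  qed
  have log_part: "\<bar>(1 / real N) * (\<Sum>n=1..N. ln (abundancy (2 * n))) - log_mean\<bar>
      \<le> (1 + err_const) * real N powr (- (1 / 2))" if N: "N > 0" for N
  proof -
    have "(1 / real N) * (\<Sum>n=1..N. ln (abundancy (2 * n))) - log_mean =
        ((\<Sum>n=1..N. ln (abundancy (2 * n))) - real N * log_mean) / real N"
      using N by (simp add: field_simps)
    also have "\<bar>\<dots>\<bar> \<le> (1 + err_const) * sqrt (real N) / real N"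
      unfolding abs_divide using log_mean_error[of N] by (simp add: divide_right_mono)
    also have "\<dots> = (1 + err_const) * real N powr (- (1 / 2))"
      using N by (simp add: powr_minus_divide powr_half_sqrt field_simps)
    finally show ?thesis .
  qed
  \<comment> \<open>Both error parts are negative powers of N; for N > 1 the logarithm is positive,
    so each can be compared with 1 / ln N.\<close>
  have "\<bar>(1 / real N) * (\<Sum>n=1..N. ln (real (aliquot (2*n)) / real (2*n))) - lambda_const\<bar>
      \<le> (2 * (1 + err_const) + D / \<theta>) * (1 / ln (real N))" if N: "N > 1" for N
  proof -
    have "\<bar>(1 / real N) * (\<Sum>n=1..N. ln (real (aliquot (2*n)) / real (2*n))) - lambda_const\<bar>
        \<le> (1 + err_const) * real N powr (- (1 / 2)) + real N powr (- \<theta>) * D"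
      using pow_part[of N] log_part[of N] N ln_aliquot_ratio_avg(1)[of N] unfolding lambda by linarith
    also have "\<dots> \<le> (1 + err_const) * ((1 / (1 / 2)) * (1 / ln (real N))) + ((1 / \<theta>) * (1 / ln (real N))) * D"
      using D E \<theta> N by (intro add_mono mult_left_mono mult_right_mono powr_neg_le_inverse_ln) auto
    also have "\<dots> = (2 * (1 + err_const) + D / \<theta>) * (1 / ln (real N))"
      by (simp add: add_divide_distrib algebra_simps)
    finally show ?thesis .
  qed
  then show ?thesis
    by (intro bigoI[of _ "2 * (1 + err_const) + D / \<theta>"] eventually_mono[OF eventually_gt_at_top[of 1]])
      auto
qed

end
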